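(* Let $n\ge 2$ and let $A=A_1\cdots A_n$ and $B=B_1\cdots B_n$ be strings over $\{\mathrm{H},\mathrm{T}\}$ such that $A$ starts with $\mathrm{HT}$, $B$ starts with $\mathrm{HH}$, and the suffix of $B$ of length $n-1$ equals the prefix of $A$ of length $n-1$ (i.e. $B_{i+1}=A_i$ for $1\le i\le n-1$). Then Bob wins the No-Flippancy game with Alice's string $A$ and Bob's string $B$.
   Context: No-Flippancy game: Alice and Bob have distinct strings $A=A_1\cdots A_n$ and $B=B_1\cdots B_n$ of the same length $n$ over the alphabet $\{\mathrm{H},\mathrm{T}\}$. Starting from the empty sequence, the players alternate turns, Alice going first, and on each turn the current player appends one letter to the sequence (the game output) as follows: let $i<n$ be the maximal length of a suffix of the current sequence that coincides with a prefix of the current player's string ($i=0$ is allowed, via the empty suffix); the player appends the letter with index $i+1$ of their own string. The game ends as soon as $A$ or $B$ appears as a block of consecutive letters in the sequence (necessarily as its suffix, no matter who made the last move); the player whose string appears first wins. If neither string ever appears, the game is infinite. *)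

theory Defs
  imports Main "HOL-Library.Sublist"
begin

datatype letter = H | T

text \<open>
  The length of the longest proper prefix of \<open>P\<close> that is a suffix of the sequence \<open>s\<close>.
  For nonempty \<open>P\<close> the set is finite and contains \<open>0\<close>, so the maximum is meaningful.
\<close>
definition overlap :: "letter list \<Rightarrow> letter list \<Rightarrow> nat" where
  "overlap P s = Max {i. i < length P \<and> suffix (take i P) s}"

text \<open>Lists are indexed from \<open>0\<close>, so this is the letter with (one-based) index \<open>overlap P s + 1\<close>.\<close>
definition next_letter :: "letter list \<Rightarrow> letter list \<Rightarrow> letter" where
  "next_letter P s = P ! overlap P s"

definition game_over :: "letter list \<Rightarrow> letter list \<Rightarrow> letter list \<Rightarrow> bool" where
  "game_over A B s \<longleftrightarrow> sublist A s \<or> sublist B s"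

text \<open>
  The sequence after \<open>k\<close> turns, Alice moving on turns 0, 2, 4, ...; once the game is over
  the sequence stays constant.
\<close>
primrec game_output :: "letter list \<Rightarrow> letter list \<Rightarrow> nat \<Rightarrow> letter list" where
  "game_output A B 0 = []"
| "game_output A B (Suc k) =
     (let s = game_output A B k in
      if game_over A B s then s
      else s @ [next_letter (if even k then A else B) s])"

definition bob_wins :: "letter list \<Rightarrow> letter list \<Rightarrow> bool" where
  "bob_wins A B \<longleftrightarrow>
     (\<exists>k. sublist B (game_output A B k) \<and> (\<forall>j\<le>k. \<not> sublist A (game_output A B j)))"

end

theory Submission imports Defs begin

text \<open>
  Whoever is to move, the sequence after \<open>k \<le> n\<close> turns is the prefix of \<open>B\<close> of length \<open>k\<close>.
  Bob simply continues his own string. When Alice moves at \<open>k \<ge> 2\<close>, the last \<open>k - 1\<close> letters form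
  a prefix of \<open>A\<close>, but all \<open>k\<close> letters do not, since \<open>A\<close> and \<open>B\<close> differ in the second letter; so
  she appends \<open>A\<^sub>k = B\<^sub>k\<^sub>+\<^sub>1\<close>.
\<close>

lemma overlap_eqI:
  assumes "i < length P" and "suffix (take i P) s"
    and "\<And>j. j < length P \<Longrightarrow> suffix (take j P) s \<Longrightarrow> j \<le> i"
  shows "overlap P s = i"
  unfolding overlap_def using assms by (intro Max_eqI) auto

lemma overlap_take_self:
  assumes "k < length P"
  shows "overlap P (take k P) = k"
  using assms by (intro overlap_eqI) (auto dest: suffix_length_le)

text \<open>Deleting the first letter of \<open>take (Suc k) B\<close> leaves
  \<open>take k A\<close>, so \<open>k\<close> is attained. A longer overlap would be all of
  \<open>take (Suc k) B\<close>, which \<open>neq\<close> excludes. This computes Alice's moves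
  after the opening.\<close>

lemma overlap_take_shifted:
  assumes len: "length A = length B" "Suc k < length B"
    and shift: "take k A = drop 1 (take (Suc k) B)"
    and neq: "take (Suc k) A \<noteq> take (Suc k) B"
  shows "overlap A (take (Suc k) B) = k"
proof (rule overlap_eqI)
  show "k < length A" using len by simp
  show "suffix (take k A) (take (Suc k) B)"
    unfolding shift by (rule suffix_drop)
next
  fix j assume j: "j < length A" "suffix (take j A) (take (Suc k) B)"
  then have "j \<le> Suc k" using len by (auto dest: suffix_length_le)
  moreover have "j \<noteq> Suc k"
  proof
    assume "j = Suc k"
    then obtain zs where zs: "take (Suc k) B = zs @ take (Suc k) A"
      using j(2) by (auto simp: suffix_def)
    have "zs = []" using arg_cong[OF zs, of length] len by simp
    with zs have "take (Suc k) A = take (Suc k) B" by simp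
    with neq show False ..
  qed
  ultimately show "j \<le> k" by simp
qed

lemma game_output_eq_take:
  assumes len: "length A = length B"
    and A: "prefix [H, T] A" and B: "prefix [H, H] B"
    and shift: "drop 1 B = take (length B - 1) A"
    and k: "k \<le> length B"
  shows "game_output A B k = take k B"
  using k
proof (induction k)
  case 0
  then show ?case by simp
next
  case (Suc k)
  have IH: "game_output A B k = take k B" and lt: "k < length B"
    using Suc by simp_all
  have not_over: "\<not> game_over A B (take k B)"
    using lt len by (auto simp: game_over_def dest: sublist_length_le)
  have "next_letter (if even k then A else B) (take k B) = B ! k"
  proof (cases "even k")
    case False
    then show ?thesis by (simp add: next_letter_def overlap_take_self lt)
  next
    case True
    show ?thesis
    proof (cases k)
      case 0
      \<comment> \<open>The opening letter is \<open>A ! 0\<close>, and both strings start with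
        \<open>H\<close>.\<close>
      have "overlap A [] = 0" using overlap_take_self[of 0 A] lt len by fastforce
      then show ?thesis using 0 A B by (auto simp: next_letter_def prefix_def)
    next
      case (Suc m)
      \<comment> \<open>Parity excludes \<open>k = 1\<close>, where both prefixes are
        \<open>[H]\<close>. From \<open>k = 2\<close> on they include the second letter, where
        \<open>A\<close> has \<open>T\<close> and \<open>B\<close> has \<open>H\<close>.\<close>
      with True obtain l where l: "m = Suc l" by (cases m) auto
      have "take m A = drop 1 (take (Suc m) B)"
        using shift lt Suc by (simp add: drop_take)
      moreover have "take (Suc m) A \<noteq> take (Suc m) B"
        using A B l by (auto simp: prefix_def)
      ultimately have "overlap A (take k B) = m"
        using overlap_take_shifted[OF len] lt Suc by simp
      moreover have "B ! k = drop 1 B ! m" using lt Suc by simp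
      then have "B ! k = A ! m" unfolding shift using lt Suc by simp
      ultimately show ?thesis using True by (simp add: next_letter_def)
    qed
  qed
  then show ?case
    using not_over lt by (simp add: IH Let_def take_Suc_conv_app_nth)
qed

theorem lemma17:
  fixes n :: nat and A B :: "letter list"
  assumes "n \<ge> 2"
    and "length A = n" and "length B = n"
    and "prefix [H, T] A"
    and "prefix [H, H] B"
    and "drop 1 B = take (n - 1) A"
  shows "bob_wins A B"
proof -
  have out: "game_output A B k = take k B" if "k \<le> n" for k
    using game_output_eq_take[of A B k] assms that by simp
  have "A \<noteq> B" using assms(4,5) by (auto simp: prefix_def)
  have "\<not> sublist A (take k B)" for k
  proof
    assume A: "sublist A (take k B)"
    \<comment> \<open>Since \<open>A\<close> and \<open>B\<close> have equal length,
      \<open>A\<close> can occur inside \<open>B\<close> only if \<open>A = B\<close>.\<close>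
    then have "sublist A B" using sublist_order.order_trans sublist_take by blast
    with \<open>A \<noteq> B\<close> show False using assms(2,3) by (auto simp: sublist_def)
  qed
  moreover have "sublist B (game_output A B n)" using out[of n] assms(3) by simp
  ultimately show ?thesis unfolding bob_wins_def using out by (intro exI[of _ n]) auto
qed

end
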